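(* Let $\mathcal{B}$ be a unital $C^*$-algebra. Let $(\mathcal{A}_0,\Phi_0)$ and $(\mathcal{A},\Phi)$ be $\mathcal{B}$-quantum probability spaces, and for each $n\in\mathbb{N}=\{1,2,\ldots\}$ let $\pi_n\colon\mathcal{A}_0\to\mathcal{A}$ be a homomorphism (almost never unital, so not $\mathcal{B}$-preserving) respecting the bimodule action of $\mathcal{B}$ (that is, $\pi_n(bab')=b\,a_n\,b'$ for $a\in\mathcal{A}_0$ and $b,b'\in\mathcal{B}$, where $a_n:=\pi_n(a)$) such that the subalgebras $\mathcal{A}_n:=\pi_n(\mathcal{A}_0)$ are conditionally boolean independent in $\mathcal{A}$. For every selection of elements $b^{(j)}\in\mathcal{A}_0$ ($j$ in an index set $J$) with $\Phi_0(b^{(j)})=0$, putting $$S_N^{(j)}:=\frac{b^{(j)}_1+\cdots+b^{(j)}_N}{\sqrt{N}},\qquad b^{(j)}_n:=\pi_n(b^{(j)}),$$ we obtain, for all $n\in\mathbb{N}$ and $j_1,\ldots,j_n\in J$, $$\lim_{N\to\infty}\Phi\bigl(S_N^{(j_1)}\cdots S_N^{(j_n)}\bigr)=\Bigl\langle\omega,\bigl(a^*(\gamma^{(j_1)})+a(\beta^{(j_1)})\bigr)\cdots\bigl(a^*(\gamma^{(j_n)})+a(\beta^{(j_n)})\bigr)\omega\Bigr\rangle,$$ where for each $j$ we denote by $\begin{pmatrix}\alpha^{(j)}&{\beta^{(j)}}^*\\ \gamma^{(j)}&\delta^{(j)}\end{pmatrix}$ the action of $b^{(j)}$ on the GNS-correspondence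 $\mathscr{E}=\mathcal{B}\oplus E$ of $\Phi_0$, and where $a^*(x)$, $a(x)$ ($x\in E$) and $\omega$ on the right-hand side are the creators, the annihilators and the vacuum of the boolean Fock module $\mathcal{F}_B(E)=\mathcal{B}\oplus E$.
   Context: $\mathcal{B}$-quantum probability space: a pair $(\mathcal{A},\Phi)$ where $\mathcal{A}$ is a unital $*$-algebra containing $\mathcal{B}$ as a unital $*$-subalgebra (with the same unit), and $\Phi$ is a conditional expectation onto $\mathcal{B}$, that is, a positive idempotent linear map from $\mathcal{A}$ onto $\mathcal{B}$ that is a $\mathcal{B}$-bimodule map ($\Phi(bab')=b\Phi(a)b'$). Conditional boolean independence: subalgebras $\mathcal{A}_k$ of a $\mathcal{B}$-quantum probability space $(\mathcal{A},\Phi)$ are conditionally boolean independent if $$\Phi(a_1\cdots a_n)=\Phi(a_1)\cdots\Phi(a_n)$$ for any $a_k\in\mathcal{A}_{\sigma(k)}$ ($1\le k\le n$) whenever $\sigma$ is such that $\sigma(k)\ne\sigma(k+1)$ ($1\le k<n$). GNS-correspondence of $(\mathcal{A}_0,\Phi_0)$: on $\mathcal{A}_0$ define the semi-inner product $\langle a,a'\rangle:=\Phi_0(a^*a')$, divide out the length-zero elements $\mathscr{N}$, and complete the pre-Hilbert $\mathcal{B}$-module $\mathcal{A}_0/\mathscr{N}$ to a Hilbert $\mathcal{B}$-module $\mathscr{E}$, on which $\mathcal{A}_0$ acts from the left by $a(a'+\mathscr{N})=aa'+\mathscr{N}$. The cyclic unit vector $\omega:=1+\mathscr{N}$ satisfies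 $\langle\omega,a\omega\rangle=\Phi_0(a)$ and is central ($b\omega=\omega b$ for $b\in\mathcal{B}$). This decomposes $\mathscr{E}$ into $\mathscr{E}=\mathcal{B}\oplus E$, where the summand isomorphic to $\mathcal{B}$ is $\omega\mathcal{B}$ and where $E=\omega^\perp$. For $a\in\mathcal{A}_0$ one denotes by $\begin{pmatrix}\alpha&\beta^*\\ \gamma&\delta\end{pmatrix}$ its action on $\mathcal{B}\oplus E$, with $\alpha\in\mathcal{B}$, $\beta,\gamma\in E$, and $\delta$ in the adjointable operators on $E$; here $\beta^*$ is the map $x\mapsto\langle\beta,x\rangle$ from $E$ to $\mathcal{B}$. Boolean Fock module: for a $\mathcal{B}$-correspondence $E$ (a Hilbert $\mathcal{B}$-module with a left action of $\mathcal{B}$ by adjointable operators), $\mathcal{F}_B(E):=\mathcal{B}\oplus E$ with vacuum $\omega:=1\in\mathcal{B}$. For $x\in E$ the creator is $a^*(x):=\begin{pmatrix}0&0\\ x&0\end{pmatrix}$, i.e. $a^*(x)(b,y)=(0,xb)$, with adjoint (annihilator) $a(x):=a^*(x)^*=\begin{pmatrix}0&x^*\\ 0&0\end{pmatrix}$, i.e. $a(x)(b,y)=(\langle x,y\rangle,0)$.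
   Formalization: The formal theorem additionally assumes Φ(π_n(a)) = Φ_0(a) for all n ≥ 1 and a in A_0 (identical distribution); without it the claim fails, e.g. for π_n = 0, where the left side vanishes but the right side need not. *)

theory Defs
  imports "HOL-Analysis.Analysis"
begin

class scaleC =
  fixes scaleC :: "complex \<Rightarrow> 'a \<Rightarrow> 'a"  (infixr "*\<^sub>C" 75)

class complex_vector = scaleC + ab_group_add +
  assumes scaleC_add_right: "c *\<^sub>C (x + y) = c *\<^sub>C x + c *\<^sub>C y"
    and scaleC_add_left: "(c + d) *\<^sub>C x = c *\<^sub>C x + d *\<^sub>C x"
    and scaleC_scaleC: "c *\<^sub>C d *\<^sub>C x = (c * d) *\<^sub>C x"
    and scaleC_one: "1 *\<^sub>C x = x"

class complex_banach = complex_vector + banach +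
  assumes scaleR_scaleC: "r *\<^sub>R x = complex_of_real r *\<^sub>C x"
    and norm_scaleC: "norm (c *\<^sub>C x) = cmod c * norm x"

text \<open>Unital complex *-algebras. The zero algebra is not excluded.\<close>

class star_algebra = complex_vector + ring + monoid_mult +
  fixes star :: "'a \<Rightarrow> 'a"
  assumes mult_scaleC_left: "(c *\<^sub>C x) * y = c *\<^sub>C (x * y)"
    and mult_scaleC_right: "x * (c *\<^sub>C y) = c *\<^sub>C (x * y)"
    and star_add: "star (x + y) = star x + star y"
    and star_scaleC: "star (c *\<^sub>C x) = cnj c *\<^sub>C star x"
    and star_mult: "star (x * y) = star y * star x"
    and star_star: "star (star x) = x"

class cstar_algebra = star_algebra + complex_banach + real_normed_algebra +
  assumes cstar_identity: "norm (star x * x) = (norm x)\<^sup>2"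

definition cstar_positive :: "'b::cstar_algebra \<Rightarrow> bool" where
  "cstar_positive x \<longleftrightarrow> (\<exists>c. x = star c * c)"

definition clinear_map :: "('a::complex_vector \<Rightarrow> 'c::complex_vector) \<Rightarrow> bool" where
  "clinear_map f \<longleftrightarrow> (\<forall>x y. f (x + y) = f x + f y) \<and> (\<forall>c x. f (c *\<^sub>C x) = c *\<^sub>C f x)"

text \<open>The inclusion of \<open>\<B>\<close> into \<open>\<A>\<close> is the injective unital *-homomorphism \<open>\<iota>\<close>; the
  conditional expectation is regarded as a map into \<open>\<B>\<close>.\<close>

locale quantum_probability_space =
  fixes \<iota> :: "'b::cstar_algebra \<Rightarrow> 'a::star_algebra"
    and \<Phi> :: "'a \<Rightarrow> 'b"
  assumes incl_linear: "clinear_map \<iota>"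
    and incl_mult: "\<iota> (x * y) = \<iota> x * \<iota> y"
    and incl_star: "\<iota> (star x) = star (\<iota> x)"
    and incl_one: "\<iota> 1 = 1"
    and incl_inj: "inj \<iota>"
    and expect_linear: "clinear_map \<Phi>"
    and expect_positive: "cstar_positive (\<Phi> (star a * a))"
    and expect_idempotent: "\<Phi> (\<iota> (\<Phi> a)) = \<Phi> a"
    and expect_onto: "surj \<Phi>"
    and expect_bimodule: "\<Phi> (\<iota> x * a * \<iota> y) = x * \<Phi> a * y"

text \<open>Homomorphisms need neither be unital nor preserve the involution.\<close>

definition bimodule_hom ::
  "('b::cstar_algebra \<Rightarrow> 'a0::star_algebra) \<Rightarrow> ('b \<Rightarrow> 'a::star_algebra) \<Rightarrow> ('a0 \<Rightarrow> 'a) \<Rightarrow> bool"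
where
  "bimodule_hom \<iota>\<^sub>0 \<iota> \<pi> \<longleftrightarrow>
     clinear_map \<pi> \<and>
     (\<forall>a a'. \<pi> (a * a') = \<pi> a * \<pi> a') \<and>
     (\<forall>x a y. \<pi> (\<iota>\<^sub>0 x * a * \<iota>\<^sub>0 y) = \<iota> x * \<pi> a * \<iota> y)"

definition cond_boolean_independent ::
  "('a::star_algebra \<Rightarrow> 'b::cstar_algebra) \<Rightarrow> 'i set \<Rightarrow> ('i \<Rightarrow> 'a set) \<Rightarrow> bool"
where
  "cond_boolean_independent \<Phi> I \<A> \<longleftrightarrow>
     (\<forall>n\<ge>1. \<forall>\<sigma> a.
        (\<forall>k\<in>{1..n}. \<sigma> k \<in> I \<and> a k \<in> \<A> (\<sigma> k)) \<longrightarrow>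
        (\<forall>k\<in>{1..<n}. \<sigma> k \<noteq> \<sigma> (k + 1)) \<longrightarrow>
        \<Phi> (prod_list (map a [1..<n+1])) = prod_list (map (\<lambda>k. \<Phi> (a k)) [1..<n+1]))"

locale hilbert_module =
  fixes rmul :: "'e::complex_banach \<Rightarrow> 'b::cstar_algebra \<Rightarrow> 'e"
    and ip :: "'e \<Rightarrow> 'e \<Rightarrow> 'b"
  assumes rmul_linear_left: "clinear_map (\<lambda>x. rmul x b)"
    and rmul_linear_right: "clinear_map (\<lambda>b. rmul x b)"
    and rmul_rmul: "rmul (rmul x b) b' = rmul x (b * b')"
    and rmul_one: "rmul x 1 = x"
    and ip_linear_right: "clinear_map (\<lambda>y. ip x y)"
    and ip_rmul_right: "ip x (rmul y b) = ip x y * b"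
    and ip_star: "star (ip x y) = ip y x"
    and ip_positive: "cstar_positive (ip x x)"
    and ip_definite: "ip x x = 0 \<Longrightarrow> x = 0"
    and norm_eq_sqrt_ip: "norm x = sqrt (norm (ip x x))"

text \<open>Adjointability makes every \<open>lmul b\<close> right linear.\<close>

locale correspondence = hilbert_module rmul ip
  for rmul :: "'e::complex_banach \<Rightarrow> 'b::cstar_algebra \<Rightarrow> 'e"
    and ip :: "'e \<Rightarrow> 'e \<Rightarrow> 'b" +
  fixes lmul :: "'b \<Rightarrow> 'e \<Rightarrow> 'e"
  assumes lmul_linear: "clinear_map (\<lambda>b. lmul b x)"
    and lmul_lmul: "lmul b (lmul b' x) = lmul (b * b') x"
    and lmul_one: "lmul 1 x = x"
    and lmul_adjoint: "ip (lmul b x) y = ip x (lmul (star b) y)"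

text \<open>The GNS-correspondence, as the completion of the quotient by the length-zero elements and
  hence up to unique isomorphism: \<open>q a\<close> is the class of \<open>a\<close>, and \<open>q\<close> has dense range. Its kernel is
  \<open>{a. \<Phi> (star a * a) = 0}\<close> by definiteness of the inner product. As \<open>\<A>\<^sub>0\<close> carries no norm, left
  multiplication by \<open>a\<close> need not be bounded, so \<open>act a\<close> is prescribed on \<open>range q\<close> only (if it is
  bounded there, that determines its extension). Elements of \<open>\<B>\<close> always act boundedly.\<close>

locale gns_correspondence =
  quantum_probability_space \<iota> \<Phi> + correspondence rmul ip "\<lambda>b. act (\<iota> b)"
  for \<iota> :: "'b::cstar_algebra \<Rightarrow> 'a::star_algebra"
    and \<Phi> :: "'a \<Rightarrow> 'b"
    and rmul :: "'e::complex_banach \<Rightarrow> 'b \<Rightarrow> 'e"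
    and ip :: "'e \<Rightarrow> 'e \<Rightarrow> 'b"
    and act :: "'a \<Rightarrow> 'e \<Rightarrow> 'e" +
  fixes q :: "'a \<Rightarrow> 'e"
  assumes q_linear: "clinear_map q"
    and q_rmul: "q (a * \<iota> b) = rmul (q a) b"
    and ip_q: "ip (q a) (q a') = \<Phi> (star a * a')"
    and q_dense: "closure (range q) = UNIV"
    and act_q: "act a (q a') = q (a * a')"

definition orth_complement :: "('e \<Rightarrow> 'e \<Rightarrow> 'b::zero) \<Rightarrow> 'e \<Rightarrow> 'e set" where
  "orth_complement ip w = {x. ip w x = 0}"

text \<open>The matrix of the action of \<open>a\<close> on \<open>\<B> \<oplus> E\<close>, where \<open>E\<close> is the orthogonal complement of
  \<open>\<omega> = q 1\<close> and \<open>(b, x)\<close> is identified with \<open>\<omega>b + x\<close>. The domain of \<open>a\<close> is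
  \<open>range q = \<omega>\<B> \<oplus> D\<close> with \<open>D\<close> dense in \<open>E\<close>; \<open>\<delta>\<close> is an adjointable operator on \<open>D\<close>. If \<open>a\<close> acts as
  an adjointable operator on the completion, then its matrix there restricts to this one, with the
  same \<open>\<alpha>\<close>, \<open>\<beta>\<close>, \<open>\<gamma>\<close>.\<close>

definition has_block_matrix ::
  "('e::complex_banach \<Rightarrow> 'b::cstar_algebra \<Rightarrow> 'e) \<Rightarrow> ('e \<Rightarrow> 'e \<Rightarrow> 'b) \<Rightarrow>
   ('a::star_algebra \<Rightarrow> 'e \<Rightarrow> 'e) \<Rightarrow> ('a \<Rightarrow> 'e) \<Rightarrow> 'a \<Rightarrow> 'b \<Rightarrow> 'e \<Rightarrow> 'e \<Rightarrow> ('e \<Rightarrow> 'e) \<Rightarrow> bool"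
where
  "has_block_matrix rmul ip act q a \<alpha> \<beta> \<gamma> \<delta> \<longleftrightarrow>
     (let \<omega> = q 1; E = orth_complement ip \<omega>; D = E \<inter> range q in
        \<beta> \<in> E \<and> \<gamma> \<in> E \<and> \<delta> ` D \<subseteq> D \<and>
        (\<exists>\<delta>'. \<delta>' ` D \<subseteq> D \<and> (\<forall>x\<in>D. \<forall>y\<in>D. ip (\<delta> x) y = ip x (\<delta>' y))) \<and>
        (\<forall>b. \<forall>x\<in>D. act a (rmul \<omega> b + x) = rmul \<omega> (\<alpha> * b + ip \<beta> x) + (rmul \<gamma> b + \<delta> x)))"

lemma (in gns_correspondence) block_matrix_exists:
  "\<exists>\<beta> \<gamma> \<delta>. has_block_matrix rmul ip act q a (\<Phi> a) \<beta> \<gamma> \<delta>"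
proof -
  have clin: "f (x + y) = f x + f y" "f (x - y) = f x - f y"
    if "clinear_map f" for f :: "'u::complex_vector \<Rightarrow> 'v::complex_vector" and x y
  proof -
    have add: "f (x + y) = f x + f y" for x y
      using that by (simp add: clinear_map_def)
    show "f (x + y) = f x + f y" by (rule add)
    show "f (x - y) = f x - f y" using add[of "x - y" y] by simp
  qed
  have star_diff: "star (x - y) = star x - star y" for x y :: 'b
    using star_add[of "x - y" y] by simp
  have star_one: "star 1 = (1::'c::star_algebra)"
    by (metis mult_1_right star_mult star_star mult_1_left)
  have ip_rmul_left: "ip (rmul x b) y = star b * ip x y" for x y b
    by (metis ip_rmul_right ip_star star_mult)
  have ip_diff_left: "ip (x - y) z = ip x z - ip y z" for x y z
    using clin(2)[OF ip_linear_right] by (metis ip_star star_diff)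
  have Phi_incl: "\<Phi> (\<iota> b) = b" for b
    by (metis expect_idempotent expect_onto surjD)
  define \<omega> where "\<omega> = q 1"
  define E where "E = orth_complement ip \<omega>"
  have \<omega>q: "ip \<omega> (q c) = \<Phi> c" for c
    by (simp add: \<omega>_def ip_q star_one)
  have \<omega>\<omega>: "ip \<omega> \<omega> = 1"
    using \<omega>q[of 1] Phi_incl[of 1] by (simp add: \<omega>_def incl_one)
  have \<omega>b: "rmul \<omega> b = q (\<iota> b)" for b
    by (simp add: \<omega>_def flip: q_rmul)
  define p where "p x = x - rmul \<omega> (ip \<omega> x)" for x
  have pE: "p x \<in> E" for x
    by (simp add: p_def E_def orth_complement_def clin(2)[OF ip_linear_right] ip_rmul_right \<omega>\<omega>)
  have p_q: "p (q c) = q (c - \<iota> (\<Phi> c))" for c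
    by (simp add: p_def \<omega>q \<omega>b clin(2)[OF q_linear])
  have ip_p_left: "ip (p x) y = ip x y" if "y \<in> E" for x y
    using that by (simp add: p_def E_def orth_complement_def ip_diff_left ip_rmul_left)
  have ip_p_right: "ip x (p y) = ip x y" if "x \<in> E" for x y
    by (metis ip_p_left ip_star that)
  define D where "D = E \<inter> range q"
  define d where "d c x = p (act c x)" for c x
  have dD: "d c ` D \<subseteq> D" for c
    using pE by (auto simp: D_def d_def act_q p_q)
  have act_adj: "ip (act c x) y = ip x (act (star c) y)" if "x \<in> D" "y \<in> D" for c x y
    using that by (auto simp: D_def act_q ip_q star_mult mult.assoc)
  have d_adj: "\<forall>x\<in>D. \<forall>y\<in>D. ip (d a x) y = ip x (d (star a) y)"
    using act_adj by (auto simp: d_def D_def ip_p_left ip_p_right)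
  have matrix: "act a (rmul \<omega> b + x) =
      rmul \<omega> (\<Phi> a * b + ip (p (q (star a))) x) + (rmul (p (q a)) b + d a x)"
    if x: "x \<in> D" for b x
  proof -
    obtain c where c: "x = q c" and xE: "x \<in> E" using x by (auto simp: D_def)
    have sum_q: "rmul \<omega> b + x = q (\<iota> b + c)"
      by (simp add: c \<omega>b clin(1)[OF q_linear])
    have L: "act a (rmul \<omega> b + x) = rmul (q a) b + act a x"
      by (simp only: sum_q) (simp only: c act_q distrib_left, simp only: clin(1)[OF q_linear] q_rmul)
    have "ip (p (q (star a))) x = ip \<omega> (act a x)"
      by (simp add: ip_p_left[OF xE]) (simp add: c act_q \<omega>q ip_q star_star)
    then have 1: "rmul \<omega> (ip (p (q (star a))) x) + d a x = act a x"
      by (simp add: d_def p_def)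
    have 2: "rmul \<omega> (\<Phi> a * b) + rmul (p (q a)) b = rmul (q a) b"
      by (simp add: p_def \<omega>q clin(2)[OF rmul_linear_left] rmul_rmul)
    show ?thesis
      unfolding L clin(1)[OF rmul_linear_right] 1[symmetric] 2[symmetric]
      by (simp add: ac_simps)
  qed
  show ?thesis
    unfolding has_block_matrix_def Let_def \<omega>_def[symmetric] E_def[symmetric] D_def[symmetric]
    using pE dD d_adj matrix by blast
qed

text \<open>Vectors of the boolean Fock module \<open>\<B> \<oplus> E\<close> are pairs. Here \<open>E\<close> is a submodule of the type
  \<open>'e\<close>; for \<open>x \<in> E\<close> the operators below leave \<open>UNIV \<times> E\<close> invariant.\<close>

definition fock_vacuum :: "'b::cstar_algebra \<times> 'e::complex_banach" where
  "fock_vacuum = (1, 0)"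

definition fock_ip ::
  "('e::complex_banach \<Rightarrow> 'e \<Rightarrow> 'b::cstar_algebra) \<Rightarrow> 'b \<times> 'e \<Rightarrow> 'b \<times> 'e \<Rightarrow> 'b" where
  "fock_ip ip u v = star (fst u) * fst v + ip (snd u) (snd v)"

definition creator ::
  "('e::complex_banach \<Rightarrow> 'b::cstar_algebra \<Rightarrow> 'e) \<Rightarrow> 'e \<Rightarrow> 'b \<times> 'e \<Rightarrow> 'b \<times> 'e" where
  "creator rmul x u = (0, rmul x (fst u))"

definition annihilator ::
  "('e::complex_banach \<Rightarrow> 'e \<Rightarrow> 'b::cstar_algebra) \<Rightarrow> 'e \<Rightarrow> 'b \<times> 'e \<Rightarrow> 'b \<times> 'e" where
  "annihilator ip x u = (ip x (snd u), 0)"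

definition normalized_sum :: "(nat \<Rightarrow> 'a0 \<Rightarrow> 'a::star_algebra) \<Rightarrow> 'a0 \<Rightarrow> nat \<Rightarrow> 'a" where
  "normalized_sum \<pi> a N = complex_of_real (1 / sqrt (real N)) *\<^sub>C (\<Sum>i=1..N. \<pi> i a)"

end

theory Submission
  imports Defs "HOL-Real_Asymp.Real_Asymp"
begin

text \<open>Write \<open>T x = \<Sum>\<^sub>k \<pi>\<^sub>k x\<close>. Multiplying \<open>\<pi>\<^sub>i x\<close> by \<open>T y\<close> either merges into the block
  \<open>\<pi>\<^sub>i (x * y)\<close> or, for each of the \<open>N - 1\<close> other indices, splits off a factor \<open>\<Phi>\<^sub>0 x\<close> by boolean
  independence. So \<open>\<Phi> (\<pi>\<^sub>i x * T y\<^sub>1 \<cdots> T y\<^sub>m)\<close> obeys a recursion not involving \<open>i\<close>. Blocks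
  consisting of a single centered element vanish, hence after division by \<open>sqrt N ^ m\<close> only the
  partition into consecutive pairs survives, with value \<open>\<Prod> \<Phi>\<^sub>0 (y\<^sub>2\<^sub>i\<^sub>-\<^sub>1 * y\<^sub>2\<^sub>i)\<close>. The Fock space
  expression gives the same product, because \<open>\<langle>\<beta>, \<gamma>'\<rangle>\<close> is \<open>\<Phi>\<^sub>0\<close> of the product of the two elements.\<close>

section \<open>Linear maps, involution and scalar powers\<close>

lemma clinear_map_add: "clinear_map f \<Longrightarrow> f (x + y) = f x + f y"
  by (simp add: clinear_map_def)

lemma clinear_map_scaleC: "clinear_map f \<Longrightarrow> f (c *\<^sub>C x) = c *\<^sub>C f x"
  by (simp add: clinear_map_def)

lemma clinear_map_zero:
  assumes "clinear_map f" shows "f 0 = 0"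
  using clinear_map_add[OF assms, of 0 0] by simp

lemma clinear_map_sum:
  assumes "clinear_map f" shows "f (\<Sum>i\<in>A. g i) = (\<Sum>i\<in>A. f (g i))"
  by (induction A rule: infinite_finite_induct)
    (simp_all add: clinear_map_zero[OF assms] clinear_map_add[OF assms])

lemma star_one: "star 1 = (1::'a::star_algebra)"
  by (metis mult_1_right star_mult star_star)

lemma star_zero: "star 0 = (0::'a::star_algebra)"
  using star_add[of 0 "0::'a"] by simp

lemma prod_list_scaleC:
  "prod_list (map (\<lambda>x. c *\<^sub>C f x) xs) = c ^ length xs *\<^sub>C prod_list (map f xs :: 'a::star_algebra list)"
  by (induction xs) (simp_all add: scaleC_one mult_scaleC_left mult_scaleC_right scaleC_scaleC mult.commute)

section \<open>The moment recursion and its limit\<close>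

text \<open>Here \<open>x\<close> is the block collected so far in one copy and \<open>ys\<close>
  lists the sums still to be expanded; \<open>real N - 1\<close> counts the copies other than the
  one holding the block.\<close>

fun moment :: "('a::star_algebra \<Rightarrow> 'b::cstar_algebra) \<Rightarrow> nat \<Rightarrow> 'a \<Rightarrow> 'a list \<Rightarrow> 'b" where
  "moment \<phi> N x [] = \<phi> x"
| "moment \<phi> N x (y # ys) = moment \<phi> N (x * y) ys + (real N - 1) *\<^sub>R (\<phi> x * moment \<phi> N y ys)"

text \<open>The value 0 at a single letter makes every odd length vanish, where no partition into
  consecutive pairs exists.\<close>

fun pair_moment :: "('a::star_algebra \<Rightarrow> 'b::cstar_algebra) \<Rightarrow> 'a list \<Rightarrow> 'b" where
  "pair_moment \<phi> [] = 1"
| "pair_moment \<phi> [x] = 0"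
| "pair_moment \<phi> (x # y # ys) = \<phi> (x * y) * pair_moment \<phi> ys"

text \<open>The block \<open>x\<close> is arbitrary and carries no normalization, so
  \<open>x * y\<close> can replace it in the induction. Absorbing a letter into the block loses a
  factor \<open>1 / sqrt N\<close>. A letter split off must merge with its successor, and the two
  factors this uses are balanced by \<open>N - 1\<close>.\<close>

lemma moment_limit:
  assumes "\<forall>y\<in>set ys. \<phi> y = 0"
  shows "(\<lambda>N. (1 / sqrt (real N)) ^ length ys *\<^sub>R moment \<phi> N x ys) \<longlonglongrightarrow> \<phi> x * pair_moment \<phi> ys"
  using assms
proof (induction ys arbitrary: x rule: length_induct)
  case (1 ys)
  \<comment> \<open>The exponent exceeds the length of \<open>zs\<close> by one: a null factor times
    a sequence that converges by induction.\<close>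
  have merged: "(\<lambda>N. (1 / sqrt (real N)) ^ Suc (length zs) *\<^sub>R moment \<phi> N w zs) \<longlonglongrightarrow> 0"
    if "length zs < length ys" "\<forall>y\<in>set zs. \<phi> y = 0" for w zs
  proof -
    have "(\<lambda>N. 1 / sqrt (real N)) \<longlonglongrightarrow> 0"
      by real_asymp
    from tendsto_scaleR[OF this "1.IH"[rule_format, OF that(1), of w]] that(2) show ?thesis
      by simp
  qed
  consider "ys = []" | y where "ys = [y]" | y z zs where "ys = y # z # zs"
    by (metis list.exhaust)
  then show ?case
  proof cases
    case 1
    then show ?thesis by simp
  next
    case 2
    then show ?thesis using "1.prems" merged[of "[]" "x * y"] by simp
  next
    case (3 y z zs)
    have "(\<lambda>N. (real N - 1) * (1 / sqrt (real N))\<^sup>2) \<longlonglongrightarrow> 1"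
      by real_asymp
    moreover have "(\<lambda>N. \<phi> x * ((1 / sqrt (real N)) ^ length zs *\<^sub>R moment \<phi> N (y * z) zs))
        \<longlonglongrightarrow> \<phi> x * (\<phi> (y * z) * pair_moment \<phi> zs)"
      using 3 "1.IH" "1.prems" by (intro tendsto_mult tendsto_const) auto
    ultimately have "(\<lambda>N. ((real N - 1) * (1 / sqrt (real N))\<^sup>2) *\<^sub>R
          (\<phi> x * ((1 / sqrt (real N)) ^ length zs *\<^sub>R moment \<phi> N (y * z) zs)))
        \<longlonglongrightarrow> 1 *\<^sub>R (\<phi> x * (\<phi> (y * z) * pair_moment \<phi> zs))"
      by (rule tendsto_scaleR)
    with merged[of "z # zs" "x * y"]
    have "(\<lambda>N. (1 / sqrt (real N)) ^ length ys *\<^sub>R moment \<phi> N (x * y) (z # zs) +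
          ((real N - 1) * (1 / sqrt (real N))\<^sup>2) *\<^sub>R
            (\<phi> x * ((1 / sqrt (real N)) ^ length zs *\<^sub>R moment \<phi> N (y * z) zs)))
        \<longlonglongrightarrow> 0 + 1 *\<^sub>R (\<phi> x * (\<phi> (y * z) * pair_moment \<phi> zs))"
      using 3 "1.prems" by (intro tendsto_add) auto
    \<comment> \<open>This removes the term of the recursion in which \<open>y\<close> is separated
      from \<open>z\<close> as well.\<close>
    moreover have "\<phi> y = 0" using 3 "1.prems" by simp
    ultimately show ?thesis
      unfolding 3 by (simp add: scaleR_right_distrib power2_eq_square mult_ac del: power_divide)
  qed
qed

section \<open>Expectations of words in boolean independent copies\<close>

locale boolean_independent_copies =
  fixes \<phi> :: "'c::star_algebra \<Rightarrow> 'b::cstar_algebra"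
    and \<Phi> :: "'a::star_algebra \<Rightarrow> 'b"
    and \<pi> :: "nat \<Rightarrow> 'c \<Rightarrow> 'a"
  assumes linear: "clinear_map \<Phi>"
    and hom: "n \<ge> 1 \<Longrightarrow> \<pi> n (x * y) = \<pi> n x * \<pi> n y"
    and distribution: "n \<ge> 1 \<Longrightarrow> \<Phi> (\<pi> n x) = \<phi> x"
    and independent: "cond_boolean_independent \<Phi> {1..} (\<lambda>n. range (\<pi> n))"
begin

text \<open>Letters carry their index explicitly, since the ranges of different
  \<open>\<pi> i\<close> may overlap.\<close>

definition word :: "(nat \<times> 'c) list \<Rightarrow> 'a" where
  "word ps = prod_list (map (\<lambda>(i, x). \<pi> i x) ps)"

lemma word_Nil [simp]: "word [] = 1"
  and word_Cons [simp]: "word ((i, x) # ps) = \<pi> i x * word ps"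
  by (simp_all add: word_def)

lemma word_append: "word (ps @ qs) = word ps * word qs"
  by (simp add: word_def)

text \<open>Adjacent letters of equal index merge by multiplicativity. The first index is recorded
  so that a letter of another index can later be put in front.\<close>

lemma alternating_word:
  assumes "ps \<noteq> []" "\<forall>p\<in>set ps. fst p \<ge> 1"
  shows "\<exists>qs. qs \<noteq> [] \<and> fst (hd qs) = fst (hd ps) \<and> (\<forall>p\<in>set qs. fst p \<ge> 1) \<and>
    distinct_adj (map fst qs) \<and> word qs = word ps"
  using assms
proof (induction ps)
  case (Cons p ps)
  obtain i x where p: "p = (i, x)" by (cases p)
  show ?case
  proof (cases "ps = []")
    case True
    then show ?thesis using Cons.prems by (intro exI[of _ "[p]"]) simp
  next
    case False
    then obtain k y qs where qs: "\<forall>p\<in>set ((k, y) # qs). fst p \<ge> 1"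
      "distinct_adj (map fst ((k, y) # qs))" "word ((k, y) # qs) = word ps"
      using Cons by (metis list.exhaust_sel list.set_intros(2) prod.exhaust)
    show ?thesis
    proof (cases "i = k")
      case True
      then show ?thesis
        using qs p by (intro exI[of _ "(i, x * y) # qs"]) (auto simp: hom mult.assoc distinct_adj_Cons)
    next
      case False
      then show ?thesis
        using qs p Cons.prems by (intro exI[of _ "(i, x) # (k, y) # qs"]) auto
    qed
  qed
qed simp

lemma expectation_alternating_word:
  assumes "qs \<noteq> []" "\<forall>p\<in>set qs. fst p \<ge> 1" "distinct_adj (map fst qs)"
  shows "\<Phi> (word qs) = prod_list (map (\<lambda>(i, x). \<phi> x) qs)"
proof -
  \<comment> \<open>Independence numbers the factors from 1, lists from 0.\<close>
  define p where "p k = qs ! (k - 1)" for k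
  define n where "n = length qs"
  have n: "n \<ge> 1" using assms(1) by (cases qs) (auto simp: n_def)
  have map_p: "map (\<lambda>k. f (p k)) [1..<n+1] = map f qs" for f :: "nat \<times> 'c \<Rightarrow> 'd"
    by (rule nth_equalityI) (simp_all add: p_def n_def nth_append del: upt_Suc)
  have fst_p: "fst (p k) \<ge> 1" if "k \<in> {1..n}" for k
  proof -
    have "p k \<in> set qs" using that by (auto simp: p_def n_def intro!: nth_mem)
    then show ?thesis using assms(2) by blast
  qed
  have ind: "\<Phi> (prod_list (map a [1..<n+1])) = prod_list (map (\<lambda>k. \<Phi> (a k)) [1..<n+1])"
    if "\<forall>k\<in>{1..n}. \<sigma> k \<in> {1..} \<and> a k \<in> range (\<pi> (\<sigma> k))"
      "\<forall>k\<in>{1..<n}. \<sigma> k \<noteq> \<sigma> (k + 1)" for \<sigma> a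
    using independent n that unfolding cond_boolean_independent_def by blast
  have adj: "\<forall>k\<in>{1..<n}. fst (p k) \<noteq> fst (p (k + 1))"
  proof
    fix k assume "k \<in> {1..<n}"
    then obtain l where "k = Suc l" "Suc l < length qs" by (cases k) (auto simp: n_def)
    then show "fst (p k) \<noteq> fst (p (k + 1))"
      using assms(3) by (auto simp: distinct_adj_conv_nth p_def)
  qed
  have "\<Phi> (word qs) = prod_list (map (\<lambda>k. \<Phi> ((\<lambda>(i, x). \<pi> i x) (p k))) [1..<n+1])"
    unfolding word_def map_p[symmetric]
    by (rule ind[of "\<lambda>k. fst (p k)"]) (use adj fst_p in \<open>auto simp: case_prod_beta\<close>)
  also have "\<dots> = prod_list (map (\<lambda>(i, x). \<phi> x) qs)"
    unfolding map_p[of "\<lambda>z. \<Phi> ((\<lambda>(i, x). \<pi> i x) z)"] using assms(2)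
    by (intro arg_cong[of _ _ prod_list] map_cong) (auto intro!: distribution)
  finally show ?thesis .
qed

text \<open>Reducing the tail to alternating form keeps its first index \<open>k\<close>, which
  differs from \<open>i\<close>. So the word stays alternating with \<open>\<pi> i x\<close> in
  front, and both expectations factorize.\<close>

lemma expectation_word_split:
  assumes "i \<ge> 1" "k \<ge> 1" "i \<noteq> k" "\<forall>p\<in>set ps. fst p \<ge> 1"
  shows "\<Phi> (\<pi> i x * word ((k, y) # ps)) = \<phi> x * \<Phi> (word ((k, y) # ps))"
proof -
  obtain qs where qs: "qs \<noteq> []" "fst (hd qs) = k" "\<forall>p\<in>set qs. fst p \<ge> 1"
    "distinct_adj (map fst qs)" "word qs = word ((k, y) # ps)"
    using alternating_word[of "(k, y) # ps"] assms by auto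
  have "\<Phi> (word ((i, x) # qs)) = prod_list (map (\<lambda>(i, x). \<phi> x) ((i, x) # qs))"
    using qs assms
    by (intro expectation_alternating_word) (auto simp: distinct_adj_Cons hd_map)
  then show ?thesis
    using qs(5) expectation_alternating_word[OF qs(1,3,4)] by simp
qed

definition copies_sum :: "nat \<Rightarrow> 'c \<Rightarrow> 'a" where
  "copies_sum N x = (\<Sum>i=1..N. \<pi> i x)"

text \<open>Expanding the first sum appends one letter to \<open>ps\<close> and leaves the leading
  \<open>(k, y)\<close> untouched, which reduces the claim to pure words.\<close>

lemma expectation_split:
  assumes "i \<ge> 1" "k \<ge> 1" "i \<noteq> k" "\<forall>p\<in>set ps. fst p \<ge> 1"
  shows "\<Phi> (\<pi> i x * (word ((k, y) # ps) * prod_list (map (copies_sum N) ys))) =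
    \<phi> x * \<Phi> (word ((k, y) # ps) * prod_list (map (copies_sum N) ys))"
  using assms(4)
proof (induction ys arbitrary: ps)
  case Nil
  then show ?case using expectation_word_split[OF assms(1-3)] by simp
next
  case (Cons z zs)
  have expand: "word ((k, y) # ps) * prod_list (map (copies_sum N) (z # zs)) =
      (\<Sum>l=1..N. word ((k, y) # (ps @ [(l, z)])) * prod_list (map (copies_sum N) zs))"
    by (simp add: copies_sum_def word_append sum_distrib_left sum_distrib_right mult.assoc)
  have "\<Phi> (\<pi> i x * (word ((k, y) # (ps @ [(l, z)])) * prod_list (map (copies_sum N) zs))) =
      \<phi> x * \<Phi> (word ((k, y) # (ps @ [(l, z)])) * prod_list (map (copies_sum N) zs))"
    if "l \<in> {1..N}" for l
    using Cons.prems that by (intro Cons.IH) auto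
  then show ?case
    unfolding expand by (simp only: sum_distrib_left clinear_map_sum[OF linear] cong: sum.cong)
qed

text \<open>Exactly one summand of the next sum has index \<open>i\<close> and merges; each of the
  others splits and has the same value by induction at its own index.\<close>

lemma expectation_eq_moment:
  assumes "i \<in> {1..N}"
  shows "\<Phi> (\<pi> i x * prod_list (map (copies_sum N) ys)) = moment \<phi> N x ys"
  using assms
proof (induction ys arbitrary: i x)
  case Nil
  then show ?case by (simp add: distribution)
next
  case (Cons y ys)
  define W where "W = prod_list (map (copies_sum N) ys)"
  have other: "\<Phi> (\<pi> i x * (\<pi> k y * W)) = \<phi> x * moment \<phi> N y ys" if "k \<in> {1..N} - {i}" for k
    using expectation_split[of i k "[]" x y N ys] Cons that by (simp add: W_def)
  have same: "\<Phi> (\<pi> i x * (\<pi> i y * W)) = moment \<phi> N (x * y) ys"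
    using Cons.IH[of i "x * y"] Cons.prems by (simp add: W_def hom mult.assoc)
  have "\<Phi> (\<pi> i x * prod_list (map (copies_sum N) (y # ys))) =
      (\<Sum>k=1..N. \<Phi> (\<pi> i x * (\<pi> k y * W)))"
    by (simp add: W_def copies_sum_def sum_distrib_left sum_distrib_right clinear_map_sum[OF linear])
  also have "\<dots> = moment \<phi> N (x * y) ys + (\<Sum>k\<in>{1..N} - {i}. \<Phi> (\<pi> i x * (\<pi> k y * W)))"
    unfolding same[symmetric] by (rule sum.remove) (use Cons.prems in auto)
  also have "(\<Sum>k\<in>{1..N} - {i}. \<Phi> (\<pi> i x * (\<pi> k y * W))) =
      (\<Sum>k\<in>{1..N} - {i}. \<phi> x * moment \<phi> N y ys)"
    by (rule sum.cong[OF refl other])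
  also have "(\<Sum>k\<in>{1..N} - {i}. \<phi> x * moment \<phi> N y ys) = (real N - 1) *\<^sub>R (\<phi> x * moment \<phi> N y ys)"
    using Cons.prems by (simp add: sum_constant_scaleR of_nat_diff)
  finally show ?case by simp
qed

theorem boolean_central_limit:
  assumes "xs \<noteq> []" "\<forall>x\<in>set xs. \<phi> x = 0"
  shows "(\<lambda>N. \<Phi> (prod_list (map (\<lambda>x. normalized_sum \<pi> x N) xs))) \<longlonglongrightarrow> pair_moment \<phi> xs"
proof -
  obtain x ys where xs: "xs = x # ys" using assms(1) by (cases xs) auto
  have phi_x: "\<phi> x = 0" using assms(2) xs by simp
  have "\<Phi> (prod_list (map (\<lambda>x. normalized_sum \<pi> x N) xs)) =
      (1 / sqrt (real N)) ^ length xs *\<^sub>R real N *\<^sub>R moment \<phi> N x ys" for N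
  proof -
    have "\<Phi> (prod_list (map (\<lambda>x. normalized_sum \<pi> x N) xs)) =
        complex_of_real (1 / sqrt (real N)) ^ length xs *\<^sub>C \<Phi> (prod_list (map (copies_sum N) xs))"
      by (simp only: normalized_sum_def prod_list_scaleC clinear_map_scaleC[OF linear]
          copies_sum_def[symmetric])
    also have "\<Phi> (prod_list (map (copies_sum N) xs)) =
        (\<Sum>i=1..N. \<Phi> (\<pi> i x * prod_list (map (copies_sum N) ys)))"
      by (simp add: xs copies_sum_def sum_distrib_right clinear_map_sum[OF linear])
    also have "\<dots> = (\<Sum>i=1..N. moment \<phi> N x ys)"
      by (rule sum.cong[OF refl expectation_eq_moment])
    also have "\<dots> = real N *\<^sub>R moment \<phi> N x ys"
      by (simp add: sum_constant_scaleR)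
    finally show ?thesis by (simp add: scaleR_scaleC)
  qed
  moreover have "(\<lambda>N. (1 / sqrt (real N)) ^ length xs *\<^sub>R real N *\<^sub>R moment \<phi> N x ys)
      \<longlonglongrightarrow> pair_moment \<phi> xs"
  proof (cases ys)
    case Nil
    then show ?thesis using xs phi_x by simp
  next
    case (Cons z zs)
    \<comment> \<open>Since \<open>\<phi> x = 0\<close>, the first letter has to merge with
      \<open>z\<close>; the factor \<open>real N\<close> from the choice of its copy cancels two
      square roots.\<close>
    have "(\<lambda>N. (1 / sqrt (real N)) ^ length zs *\<^sub>R moment \<phi> N (x * z) zs) \<longlonglongrightarrow> pair_moment \<phi> xs"
      using moment_limit[of zs \<phi> "x * z"] assms(2) xs Cons by simp
    \<comment> \<open>The cancellation needs \<open>N > 0\<close>, because \<open>1 / sqrt 0\<close>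
      is 0.\<close>
    moreover have "\<forall>\<^sub>F N in sequentially.
        (1 / sqrt (real N)) ^ length zs *\<^sub>R moment \<phi> N (x * z) zs =
        (1 / sqrt (real N)) ^ length xs *\<^sub>R real N *\<^sub>R moment \<phi> N x ys"
      using eventually_gt_at_top[of 0]
    proof eventually_elim
      case (elim N)
      then show ?case using phi_x xs Cons by (simp add: field_simps)
    qed
    ultimately show ?thesis by (rule Lim_transform_eventually)
  qed
  ultimately show ?thesis by simp
qed

end

section \<open>Matrix entries of the GNS action and Fock vacuum expectations\<close>

context gns_correspondence
begin

lemma ip_vacuum: "ip (q 1) (q c) = \<Phi> c"
  by (simp add: ip_q star_one)

lemma vacuum_unit: "ip (q 1) (q 1) = 1"
  by (metis ip_vacuum incl_one expect_idempotent expect_onto surjD)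

lemma q_zero: "q 0 = 0"
  by (rule clinear_map_zero[OF q_linear])

text \<open>Pairing with the unit vector \<open>q 1\<close> extracts the first row, as
  \<open>\<gamma>\<close> and the values of \<open>\<delta>\<close> are orthogonal to it.\<close>

lemma block_matrix_expectation:
  assumes "has_block_matrix rmul ip act q a \<alpha> \<beta> \<gamma> \<delta>" "ip (q 1) (q c) = 0"
  shows "ip (q 1) (act a (rmul (q 1) x + q c)) = \<alpha> * x + ip \<beta> (q c)"
proof -
  have c: "q c \<in> orth_complement ip (q 1) \<inter> range q"
    using assms(2) by (simp add: orth_complement_def)
  have gamma: "ip (q 1) \<gamma> = 0" and delta: "ip (q 1) (\<delta> (q c)) = 0"
    and act: "act a (rmul (q 1) x + q c) = rmul (q 1) (\<alpha> * x + ip \<beta> (q c)) + (rmul \<gamma> x + \<delta> (q c))"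
    using assms(1) c by (auto simp: has_block_matrix_def Let_def orth_complement_def)
  show ?thesis
    unfolding act
    by (simp add: clinear_map_add[OF ip_linear_right] ip_rmul_right gamma delta vacuum_unit)
qed

text \<open>Applying \<open>a\<close> to \<open>q 1\<close> gives \<open>q a\<close>, whose
  component along \<open>q 1\<close> is \<open>\<alpha> = \<Phi> a = 0\<close>, so only
  \<open>\<gamma>\<close> remains.\<close>

lemma block_matrix_column:
  assumes "has_block_matrix rmul ip act q a \<alpha> \<beta> \<gamma> \<delta>" "\<Phi> a = 0"
  shows "\<gamma> = q a"
proof -
  have "\<alpha> = 0"
    using block_matrix_expectation[OF assms(1), of 0 1] assms(2)
    by (simp add: q_zero rmul_one act_q ip_vacuum clinear_map_zero[OF ip_linear_right])
  have zero: "0 \<in> orth_complement ip (q 1) \<inter> range q"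
    using clinear_map_zero[OF ip_linear_right] q_zero by (auto simp: orth_complement_def intro: range_eqI[of _ _ 0])
  have act: "act a (rmul (q 1) x) = rmul (q 1) (\<alpha> * x) + (rmul \<gamma> x + \<delta> 0)" for x
    using assms(1) zero clinear_map_zero[OF ip_linear_right]
    unfolding has_block_matrix_def Let_def by (metis add_0_right)
  have rmul_zero: "rmul y 0 = 0" for y
    by (rule clinear_map_zero[OF rmul_linear_right])
  \<comment> \<open>The matrix gives \<open>\<delta>\<close> as a bare function, so its value at 0
    is read off from the action on the zero vector.\<close>
  have "act a 0 = 0"
    using act_q[of a 0] by (simp add: q_zero)
  then have "\<delta> 0 = 0"
    using act[of 0] by (simp add: rmul_zero)
  then show ?thesis
    using act[of 1] \<open>\<alpha> = 0\<close> by (simp add: rmul_zero rmul_one act_q)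
qed

text \<open>As \<open>\<gamma>' = q a'\<close> is orthogonal to \<open>q 1\<close>, its pairing with
  \<open>\<beta>\<close> is the component of \<open>act a (q a') = q (a * a')\<close> along
  \<open>q 1\<close>.\<close>

lemma block_matrix_pairing:
  assumes "has_block_matrix rmul ip act q a \<alpha> \<beta> \<gamma> \<delta>"
    and "has_block_matrix rmul ip act q a' \<alpha>' \<beta>' \<gamma>' \<delta>'" "\<Phi> a' = 0"
  shows "ip \<beta> \<gamma>' = \<Phi> (a * a')"
  using block_matrix_expectation[OF assms(1), of a' 0] assms(3)
    clinear_map_zero[OF rmul_linear_right]
  by (simp add: block_matrix_column[OF assms(2,3)] ip_vacuum act_q)

text \<open>Each operator exchanges the two summands of the Fock module, so the induction takes two
  letters at a time: the inner one creates \<open>\<gamma> k\<close> from the scalar component and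
  the outer one annihilates it with \<open>\<beta> j\<close>.\<close>

lemma fock_pair_moment:
  assumes "\<forall>j\<in>set js. \<Phi> (b j) = 0"
    and "\<forall>j\<in>set js. has_block_matrix rmul ip act q (b j) (\<alpha> j) (\<beta> j) (\<gamma> j) (\<delta> j)"
  shows "fst (foldr (\<lambda>j u. creator rmul (\<gamma> j) u + annihilator ip (\<beta> j) u) js fock_vacuum) =
    pair_moment \<Phi> (map b js)"
  using assms
proof (induction js rule: induct_list012)
  case 1
  then show ?case by (simp add: fock_vacuum_def)
next
  case (2 j)
  then show ?case
    by (simp add: fock_vacuum_def creator_def annihilator_def clinear_map_zero[OF ip_linear_right])
next
  case (3 j k js)
  have "ip (\<beta> j) (\<gamma> k) = \<Phi> (b j * b k)"
    using 3 by (intro block_matrix_pairing) auto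
  then show ?case
    using 3 by (simp add: creator_def annihilator_def ip_rmul_right)
qed

lemma fock_ip_vacuum: "fock_ip ip fock_vacuum u = fst u"
proof -
  have "ip 0 v = 0" for v
    using ip_star[of v 0] by (simp add: clinear_map_zero[OF ip_linear_right] star_zero)
  then show ?thesis by (simp add: fock_ip_def fock_vacuum_def star_one)
qed

end

section \<open>Convergence to the vacuum expectation\<close>

theorem mainTheorem1:
  fixes \<iota>\<^sub>0 :: "'b::cstar_algebra \<Rightarrow> 'a0::star_algebra"
    and \<Phi>\<^sub>0 :: "'a0 \<Rightarrow> 'b"
    and \<iota> :: "'b \<Rightarrow> 'a::star_algebra"
    and \<Phi> :: "'a \<Rightarrow> 'b"
    and \<pi> :: "nat \<Rightarrow> 'a0 \<Rightarrow> 'a"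
    and rmul :: "'e::complex_banach \<Rightarrow> 'b \<Rightarrow> 'e"
    and ip :: "'e \<Rightarrow> 'e \<Rightarrow> 'b"
    and act :: "'a0 \<Rightarrow> 'e \<Rightarrow> 'e"
    and q :: "'a0 \<Rightarrow> 'e"
    and J :: "'j set"
    and b :: "'j \<Rightarrow> 'a0"
    and \<alpha> :: "'j \<Rightarrow> 'b"
    and \<beta> \<gamma> :: "'j \<Rightarrow> 'e"
    and \<delta> :: "'j \<Rightarrow> 'e \<Rightarrow> 'e"
    and js :: "'j list"
  assumes "quantum_probability_space \<iota>\<^sub>0 \<Phi>\<^sub>0"
    and "quantum_probability_space \<iota> \<Phi>"
    and "\<And>n. n \<ge> 1 \<Longrightarrow> bimodule_hom \<iota>\<^sub>0 \<iota> (\<pi> n)"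
    and "\<And>n a. n \<ge> 1 \<Longrightarrow> \<Phi> (\<pi> n a) = \<Phi>\<^sub>0 a"
    and "cond_boolean_independent \<Phi> {1..} (\<lambda>n. range (\<pi> n))"
    and "gns_correspondence \<iota>\<^sub>0 \<Phi>\<^sub>0 rmul ip act q"
    and "\<And>j. j \<in> J \<Longrightarrow> \<Phi>\<^sub>0 (b j) = 0"
    and "\<And>j. j \<in> J \<Longrightarrow> has_block_matrix rmul ip act q (b j) (\<alpha> j) (\<beta> j) (\<gamma> j) (\<delta> j)"
    and "js \<noteq> []" and "set js \<subseteq> J"
  shows "(\<lambda>N. \<Phi> (prod_list (map (\<lambda>j. normalized_sum \<pi> (b j) N) js)))
         \<longlonglongrightarrow> fock_ip ip fock_vacuum
               (foldr (\<lambda>j u. creator rmul (\<gamma> j) u + annihilator ip (\<beta> j) u) js fock_vacuum)"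
proof -
  interpret Q: quantum_probability_space \<iota> \<Phi> by fact
  interpret G: gns_correspondence \<iota>\<^sub>0 \<Phi>\<^sub>0 rmul ip act q by fact
  interpret boolean_independent_copies \<Phi>\<^sub>0 \<Phi> \<pi>
    using assms(3-5) Q.expect_linear
    by unfold_locales (auto simp: bimodule_hom_def)
  have "(\<lambda>N. \<Phi> (prod_list (map (\<lambda>x. normalized_sum \<pi> x N) (map b js))))
      \<longlonglongrightarrow> pair_moment \<Phi>\<^sub>0 (map b js)"
    using assms(7,9,10) by (intro boolean_central_limit) auto
  moreover have "fst (foldr (\<lambda>j u. creator rmul (\<gamma> j) u + annihilator ip (\<beta> j) u) js fock_vacuum) =
      pair_moment \<Phi>\<^sub>0 (map b js)"
    using assms(7,8,10) by (intro G.fock_pair_moment) auto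
  ultimately show ?thesis
    by (simp add: G.fock_ip_vacuum comp_def)
qed

end
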